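(* Let $A_1,\ldots,A_k$ be complex symmetric $n\times n$ matrices and assume the subspace $\mathcal{V}$ of $M_n(\mathbb{C})$ they span contains a nonsingular matrix. There exist diagonal matrices $\Lambda_i$ and a nonsingular $R\in M_n(\mathbb{C})$ with $A_i=R\Lambda_iR^T$ for all $i=1,\ldots,k$ if and only if both of the following hold: (a) there exists a nonsingular $A\in\mathcal{V}$ such that $A^{-1}\mathcal{V}$ is a commuting subspace (equivalently, $A^{-1}\mathcal{V}$ is a commuting subspace for every nonsingular $A\in\mathcal{V}$); (b) there exists an invertible $B\in\mathcal{V}$ such that the matrices $B^{-1}A_i$ ($i=1,\ldots,k$) are all diagonalizable.
   Context: $A^{-1}\mathcal{V}=\{A^{-1}M: M\in\mathcal{V}\}$. A subspace of matrices is commuting if any two of its elements commute. *)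

theory Defs
  imports "HOL-Analysis.Analysis"
begin

definition matrix_scale :: "'a::times \<Rightarrow> 'a^'n^'m \<Rightarrow> 'a^'n^'m" where
  "matrix_scale c M = (\<chi> i j. c * M $ i $ j)"

text \<open>The unqualified \<open>span\<close> and \<open>subspace\<close> are real; those qualified with \<open>matrix_space\<close>
  are over the field of the matrix entries, so complex-linear for complex matrices.\<close>

interpretation matrix_space: vector_space "matrix_scale :: 'a::field \<Rightarrow> 'a^'n^'m \<Rightarrow> 'a^'n^'m"
  by unfold_locales (simp_all add: matrix_scale_def vec_eq_iff algebra_simps)

definition symmetric_matrix :: "'a^'n^'n \<Rightarrow> bool" where
  "symmetric_matrix M \<longleftrightarrow> transpose M = M"

definition diagonal_matrix :: "'a::zero^'n^'n \<Rightarrow> bool" where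
  "diagonal_matrix M \<longleftrightarrow> (\<forall>i j. i \<noteq> j \<longrightarrow> M $ i $ j = 0)"

definition diagonalizable_matrix :: "'a::field^'n^'n \<Rightarrow> bool" where
  "diagonalizable_matrix M \<longleftrightarrow>
     (\<exists>P D :: 'a^'n^'n. invertible P \<and> diagonal_matrix D \<and> M = P ** D ** matrix_inv P)"

definition commuting_subspace :: "('a::field^'n^'n) set \<Rightarrow> bool" where
  "commuting_subspace W \<longleftrightarrow>
     matrix_space.subspace W \<and> (\<forall>X\<in>W. \<forall>Y\<in>W. X ** Y = Y ** X)"

definition inv_translate :: "'a::field^'n^'n \<Rightarrow> ('a^'n^'n) set \<Rightarrow> ('a^'n^'n) set" where
  "inv_translate A V = {matrix_inv A ** M |M. M \<in> V}"

end

theory Submission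
  imports Defs
begin

text \<open>For the converse, let \<open>B\<close> be an invertible element of the span and regard it as the
  nondegenerate symmetric bilinear form \<open>b(x, y) = x\<^sup>T B y\<close>. The matrices \<open>X\<^sub>i = B\<^sup>-\<^sup>1 A\<^sub>i\<close> commute and
  are diagonalizable, so their joint eigenvectors span the space; they are also self-adjoint
  for \<open>b\<close>, so joint eigenvectors with different eigenvalues are \<open>b\<close>-orthogonal. A Gram--Schmidt
  argument, with polarization to exclude isotropic vectors, then gives a \<open>b\<close>-orthogonal basis of
  joint eigenvectors. If these are the columns of \<open>P\<close>, all \<open>P\<^sup>T A\<^sub>i P\<close> are diagonal and
  \<open>R = (P\<^sup>T)\<^sup>-\<^sup>1\<close> works.\<close>

section \<open>Matrix algebra\<close>

lemma matrix_scale_mult_left: "matrix_scale c M ** N = matrix_scale c (M ** N)"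
  for M :: "'a::field^'n^'m" and N :: "'a^'p^'n"
  by (simp add: matrix_scale_def matrix_matrix_mult_def vec_eq_iff sum_distrib_left mult.assoc)

lemma matrix_scale_mult_right: "M ** matrix_scale c N = matrix_scale c (M ** N)"
  for M :: "'a::field^'n^'m" and N :: "'a^'p^'n"
  by (simp add: matrix_scale_def matrix_matrix_mult_def vec_eq_iff sum_distrib_left
      mult.left_commute)

lemma transpose_matrix_scale: "transpose (matrix_scale c M) = matrix_scale c (transpose M)"
  by (simp add: matrix_scale_def transpose_def vec_eq_iff)

lemma transpose_add: "transpose (M + N) = transpose M + transpose N"
  by (simp add: transpose_def vec_eq_iff)

lemma transpose_0: "transpose 0 = 0"
  by (simp add: transpose_def vec_eq_iff)

text \<open>By minimality of spans, symmetry passes from the generators \<open>A i\<close> to all of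
  \<open>V\<close>, in particular to \<open>B\<close>.\<close>

lemma subspace_symmetric_matrix:
  "matrix_space.subspace {M :: 'a::field^'n^'n. symmetric_matrix M}"
  by (simp add: matrix_space.subspace_def symmetric_matrix_def transpose_matrix_scale
      transpose_add transpose_0)

lemma matrix_add_rdistrib: "(A + B) ** C = A ** C + B ** C"
  by (simp add: matrix_matrix_mult_def vec_eq_iff sum.distrib distrib_right)

text \<open>The map sending \<open>M\<close> to \<open>P ** M ** Q\<close> is linear. It serves with
  \<open>Q = mat 1\<close> for translates by an inverse and with \<open>Q = transpose P\<close> for
  congruences of diagonal matrices.\<close>

lemma subspace_sandwich:
  fixes P Q :: "'a::field^'n^'n"
  assumes "matrix_space.subspace W"
  shows "matrix_space.subspace {P ** M ** Q |M. M \<in> W}"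
  unfolding matrix_space.subspace_def
proof (intro conjI ballI allI)
  have "P ** 0 ** Q = 0" by (simp add: matrix_matrix_mult_def vec_eq_iff)
  then show "0 \<in> {P ** M ** Q |M. M \<in> W}"
    using matrix_space.subspace_0[OF assms] by force
next
  fix X Y assume "X \<in> {P ** M ** Q |M. M \<in> W}" "Y \<in> {P ** M ** Q |M. M \<in> W}"
  then obtain M N where "X = P ** M ** Q" "Y = P ** N ** Q" "M \<in> W" "N \<in> W" by blast
  then have "X + Y = P ** (M + N) ** Q" "M + N \<in> W"
    using matrix_space.subspace_add[OF assms]
    by (auto simp: matrix_add_ldistrib matrix_add_rdistrib)
  then show "X + Y \<in> {P ** M ** Q |M. M \<in> W}" by blast
next
  fix c X assume "X \<in> {P ** M ** Q |M. M \<in> W}"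
  then obtain M where "X = P ** M ** Q" "M \<in> W" by blast
  then have "matrix_scale c X = P ** matrix_scale c M ** Q" "matrix_scale c M \<in> W"
    using matrix_space.subspace_scale[OF assms]
    by (auto simp: matrix_scale_mult_left matrix_scale_mult_right)
  then show "matrix_scale c X \<in> {P ** M ** Q |M. M \<in> W}" by blast
qed

lemma subspace_inv_translate:
  "matrix_space.subspace V \<Longrightarrow> matrix_space.subspace (inv_translate C V)"
  using subspace_sandwich[of V "matrix_inv C" "mat 1"] by (simp add: inv_translate_def)

section \<open>Inverses and change of the base matrix\<close>

lemma
  fixes M :: "'a::field^'n^'n"
  assumes "invertible M"
  shows matrix_inv_right [simp]: "M ** matrix_inv M = mat 1"
    and matrix_inv_left [simp]: "matrix_inv M ** M = mat 1"
  using someI_ex[OF assms[unfolded invertible_def]] unfolding matrix_inv_def by auto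

lemma matrix_inv_unique:
  fixes M :: "'a::field^'n^'n"
  assumes "M ** N = mat 1" "N ** M = mat 1"
  shows "matrix_inv M = N"
proof -
  have "invertible M" using assms unfolding invertible_def by blast
  then have "matrix_inv M ** M ** N = N" by simp
  then show ?thesis by (metis assms(1) matrix_mul_assoc matrix_mul_rid)
qed

lemma invertible_transpose: "invertible M \<Longrightarrow> invertible (transpose M)"
  for M :: "'a::field^'n^'n"
  unfolding invertible_def by (metis matrix_transpose_mul transpose_mat)

lemma matrix_inv_mult:
  fixes M N :: "'a::field^'n^'n"
  assumes "invertible M" "invertible N"
  shows "matrix_inv (M ** N) = matrix_inv N ** matrix_inv M"
proof (rule matrix_inv_unique)
  show "M ** N ** (matrix_inv N ** matrix_inv M) = mat 1"
    by (metis assms matrix_inv_right matrix_mul_assoc matrix_mul_rid)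
  show "matrix_inv N ** matrix_inv M ** (M ** N) = mat 1"
    by (metis assms matrix_inv_left matrix_mul_assoc matrix_mul_rid)
qed

lemma matrix_inv_commute:
  fixes M N :: "'a::field^'n^'n"
  assumes "invertible M" "M ** N = N ** M"
  shows "matrix_inv M ** N = N ** matrix_inv M"
proof -
  have "matrix_inv M ** N = matrix_inv M ** (N ** M) ** matrix_inv M"
    by (metis assms(1) matrix_inv_right matrix_mul_assoc matrix_mul_rid)
  also have "\<dots> = matrix_inv M ** (M ** N) ** matrix_inv M"
    by (simp add: assms(2))
  also have "\<dots> = N ** matrix_inv M"
    by (metis assms(1) matrix_inv_left matrix_mul_assoc matrix_mul_lid)
  finally show ?thesis .
qed

lemma invertible_matrix_inv: "invertible M \<Longrightarrow> invertible (matrix_inv M)"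
  for M :: "'a::field^'n^'n"
  using matrix_inv_left matrix_inv_right unfolding invertible_def by blast

text \<open>The matrix \<open>Y = C\<^sup>-\<^sup>1 D\<close> lies in the commuting space
  \<open>C\<^sup>-\<^sup>1 V\<close>, so its inverse \<open>Z\<close> commutes with that whole
  space. Since \<open>D\<^sup>-\<^sup>1 M = Z C\<^sup>-\<^sup>1 M\<close>, a product of two such
  elements is \<open>Z Z\<close> times a product whose factors may be exchanged.\<close>

lemma commuting_inv_translate_change_base:
  fixes C D :: "'a::field^'n^'n"
  assumes V: "matrix_space.subspace V" and C: "invertible C"
    and D: "D \<in> V" "invertible D" and comm: "commuting_subspace (inv_translate C V)"
  shows "commuting_subspace (inv_translate D V)"
proof -
  define Y where "Y = matrix_inv C ** D"
  define Z where "Z = matrix_inv Y"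
  have Y: "invertible Y"
    unfolding Y_def using C D invertible_matrix_inv invertible_mult by blast
  have cc: "(matrix_inv C ** M) ** (matrix_inv C ** N) = (matrix_inv C ** N) ** (matrix_inv C ** M)"
    if "M \<in> V" "N \<in> V" for M N
    using comm that unfolding commuting_subspace_def inv_translate_def by blast
  have Z: "Z ** (matrix_inv C ** M) = (matrix_inv C ** M) ** Z" if "M \<in> V" for M
    unfolding Z_def by (rule matrix_inv_commute[OF Y]) (simp add: Y_def cc D that)
  have "matrix_inv D = Z ** matrix_inv C"
  proof -
    have "D = C ** Y"
      unfolding Y_def by (metis C matrix_inv_right matrix_mul_assoc matrix_mul_lid)
    then show ?thesis unfolding Z_def by (simp add: matrix_inv_mult[OF C Y])
  qed
  then have eq: "matrix_inv D ** M = Z ** (matrix_inv C ** M)" for M :: "'a^'n^'n"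
    by (simp add: matrix_mul_assoc)
  have "(matrix_inv D ** M) ** (matrix_inv D ** N) = (matrix_inv D ** N) ** (matrix_inv D ** M)"
    if "M \<in> V" "N \<in> V" for M N
  proof -
    have "(matrix_inv D ** M) ** (matrix_inv D ** N)
        = Z ** (Z ** ((matrix_inv C ** M) ** (matrix_inv C ** N)))"
      unfolding eq by (metis Z matrix_mul_assoc that(1))
    also have "\<dots> = (matrix_inv D ** N) ** (matrix_inv D ** M)"
      unfolding eq cc[OF that] by (metis Z matrix_mul_assoc that(2))
    finally show ?thesis .
  qed
  with subspace_inv_translate[OF V] show ?thesis
    unfolding commuting_subspace_def inv_translate_def by blast
qed

section \<open>Diagonal and diagonalizable matrices\<close>

lemma diagonal_matrix_mult:
  fixes D E :: "'a::field^'n^'n"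
  assumes "diagonal_matrix D" "diagonal_matrix E"
  shows "D ** E = (\<chi> i j. if i = j then D $ i $ i * E $ i $ i else 0)"
proof -
  have "(\<Sum>k\<in>UNIV. D $ i $ k * E $ k $ j) = (if i = j then D $ i $ i * E $ i $ i else 0)" for i j
  proof -
    have "(\<Sum>k\<in>UNIV. D $ i $ k * E $ k $ j) = (\<Sum>k\<in>UNIV. if k = i then D $ i $ i * E $ i $ j else 0)"
      by (rule sum.cong) (use assms(1) in \<open>auto simp: diagonal_matrix_def\<close>)
    then show ?thesis using assms(2) by (auto simp: diagonal_matrix_def)
  qed
  then show ?thesis by (simp add: matrix_matrix_mult_def vec_eq_iff)
qed

lemma subspace_diagonal_matrix:
  "matrix_space.subspace {D :: 'a::field^'n^'n. diagonal_matrix D}"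
  by (simp add: matrix_space.subspace_def diagonal_matrix_def matrix_scale_def)

lemma diagonal_matrix_inv:
  fixes D :: "'a::field^'n^'n"
  assumes "diagonal_matrix D" "invertible D"
  shows "diagonal_matrix (matrix_inv D)"
proof -
  define E :: "'a^'n^'n" where "E = (\<chi> i j. if i = j then inverse (D $ i $ i) else 0)"
  have E: "diagonal_matrix E" by (simp add: E_def diagonal_matrix_def)
  \<comment> \<open>A zero diagonal entry would make a whole row of \<open>D\<close> vanish, and
    with it a diagonal entry of \<open>D ** matrix_inv D\<close>.\<close>
  have nz: "D $ i $ i \<noteq> 0" for i
  proof
    assume 0: "D $ i $ i = 0"
    have "(D ** matrix_inv D) $ i $ i = 0"
      unfolding matrix_matrix_mult_def using 0 assms(1)
      by (auto simp: diagonal_matrix_def intro!: sum.neutral) (metis)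
    then show False by (simp add: matrix_inv_right[OF assms(2)] mat_def)
  qed
  have "D ** E = mat 1" "E ** D = mat 1"
    unfolding diagonal_matrix_mult[OF assms(1) E] diagonal_matrix_mult[OF E assms(1)]
    using nz by (auto simp: E_def mat_def vec_eq_iff)
  then show ?thesis using E matrix_inv_unique by metis
qed

text \<open>\<open>Pr c\<close> is the projection onto the eigenspace for \<open>c\<close> along the
  other eigenspaces; it is zero if \<open>c\<close> is not an eigenvalue, so the last two properties
  hold for every \<open>c\<close>. It is the conjugate by \<open>P\<close> of the diagonal 0-1
  matrix that marks the diagonal entries of \<open>D\<close> equal to \<open>c\<close>.\<close>

lemma diagonalizable_spectral_projections:
  fixes M :: "'a::field^'n^'n"
  assumes "diagonalizable_matrix M"
  obtains Pr :: "'a \<Rightarrow> 'a^'n^'n" and S where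
    "finite S" "(\<Sum>c\<in>S. Pr c) = mat 1" "\<And>c. M ** Pr c = matrix_scale c (Pr c)"
    "\<And>c N. N ** M = M ** N \<Longrightarrow> N ** Pr c = Pr c ** N"
proof -
  obtain P D :: "'a^'n^'n" where P: "invertible P" and D: "diagonal_matrix D"
    and M: "M = P ** D ** matrix_inv P"
    using assms unfolding diagonalizable_matrix_def by blast
  define Q where "Q = matrix_inv P"
  have PQ: "P ** Q = mat 1" "Q ** P = mat 1"
    by (simp_all add: Q_def P)
  define E :: "'a \<Rightarrow> 'a^'n^'n" where "E c = (\<chi> i j. if i = j \<and> D $ i $ i = c then 1 else 0)" for c
  define S where "S = range (\<lambda>i. D $ i $ i)"
  have E: "diagonal_matrix (E c)" for c by (simp add: E_def diagonal_matrix_def)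
  have Esum: "(\<Sum>c\<in>S. E c) = mat 1"
  proof -
    have "(\<Sum>c\<in>S. E c $ i $ j) = mat 1 $ i $ j" for i j
    proof -
      have "(\<Sum>c\<in>S. E c $ i $ j) = (\<Sum>c\<in>S. if c = D $ i $ i then (if i = j then 1 else 0) else 0)"
        by (rule sum.cong) (auto simp: E_def)
      also have "\<dots> = mat 1 $ i $ j" by (simp add: S_def mat_def)
      finally show ?thesis .
    qed
    then show ?thesis by (simp add: vec_eq_iff)
  qed
  have DE: "D ** E c = matrix_scale c (E c)" for c
    unfolding diagonal_matrix_mult[OF D E] by (auto simp: E_def matrix_scale_def vec_eq_iff)
  have diag_r: "(X ** F) $ i $ j = X $ i $ j * F $ j $ j" if "diagonal_matrix F"
    for X F :: "'a^'n^'n" and i j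
  proof -
    have "(\<Sum>k\<in>UNIV. X $ i $ k * F $ k $ j) = (\<Sum>k\<in>UNIV. if k = j then X $ i $ j * F $ j $ j else 0)"
      by (rule sum.cong) (use that in \<open>auto simp: diagonal_matrix_def\<close>)
    then show ?thesis by (simp add: matrix_matrix_mult_def)
  qed
  have diag_l: "(F ** X) $ i $ j = F $ i $ i * X $ i $ j" if "diagonal_matrix F"
    for X F :: "'a^'n^'n" and i j
  proof -
    have "(\<Sum>k\<in>UNIV. F $ i $ k * X $ k $ j) = (\<Sum>k\<in>UNIV. if k = i then F $ i $ i * X $ i $ j else 0)"
      by (rule sum.cong) (use that in \<open>auto simp: diagonal_matrix_def\<close>)
    then show ?thesis by (simp add: matrix_matrix_mult_def)
  qed
  \<comment> \<open>Commuting with \<open>D\<close> forces \<open>X\<close> to vanish at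
    \<open>(i, j)\<close> whenever the \<open>i\<close>-th and \<open>j\<close>-th diagonal entries
    of \<open>D\<close> differ; where they agree, so do those of \<open>E c\<close>.\<close>
  have Ecomm: "X ** E c = E c ** X" if "X ** D = D ** X" for X c
  proof -
    have "X $ i $ j * D $ j $ j = D $ i $ i * X $ i $ j" for i j
      by (metis that diag_l[OF D] diag_r[OF D])
    then have "D $ i $ i = D $ j $ j \<or> X $ i $ j = 0" for i j
      by (metis mult.commute mult_cancel_right)
    then have "X $ i $ j * E c $ j $ j = E c $ i $ i * X $ i $ j" for i j
      by (cases "X $ i $ j = 0") (simp_all add: E_def, metis)
    then show ?thesis by (simp add: vec_eq_iff diag_l[OF E] diag_r[OF E])
  qed
  show thesis
  proof (rule that[of S "\<lambda>c. P ** E c ** Q"])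
    show "finite S" by (simp add: S_def)
    have "(\<Sum>c\<in>T. P ** E c ** Q) = P ** (\<Sum>c\<in>T. E c) ** Q" if "finite T" for T
      using that
    proof induction
      case empty
      then show ?case by (simp add: matrix_matrix_mult_def vec_eq_iff)
    next
      case (insert x F)
      then show ?case by (simp add: matrix_add_ldistrib matrix_add_rdistrib)
    qed
    then show "(\<Sum>c\<in>S. P ** E c ** Q) = mat 1" using Esum PQ by (simp add: S_def)
  next
    fix c
    have "M ** (P ** E c ** Q) = P ** (D ** E c) ** Q"
      unfolding M Q_def[symmetric] by (metis PQ(2) matrix_mul_assoc matrix_mul_rid)
    then show "M ** (P ** E c ** Q) = matrix_scale c (P ** E c ** Q)"
      by (simp add: DE matrix_scale_mult_left matrix_scale_mult_right)
  next
    fix c N assume N: "N ** M = M ** N"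
    \<comment> \<open>This is \<open>N\<close> written in the eigenbasis of \<open>M\<close>, where
      commuting with \<open>M\<close> becomes commuting with \<open>D\<close>.\<close>
    define X where "X = Q ** N ** P"
    have "X ** D = Q ** (N ** M) ** P"
      unfolding X_def M Q_def[symmetric] by (metis PQ(2) matrix_mul_assoc matrix_mul_rid)
    also have "\<dots> = D ** X"
      unfolding N unfolding X_def M Q_def[symmetric]
      by (metis PQ(2) matrix_mul_assoc matrix_mul_lid)
    finally have "X ** E c = E c ** X" by (rule Ecomm)
    moreover have "N ** (P ** E c ** Q) = P ** (X ** E c) ** Q"
      unfolding X_def by (metis PQ(1) matrix_mul_assoc matrix_mul_lid)
    moreover have "(P ** E c ** Q) ** N = P ** (E c ** X) ** Q"
      unfolding X_def by (metis PQ(1) matrix_mul_assoc matrix_mul_rid)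
    ultimately show "N ** (P ** E c ** Q) = (P ** E c ** Q) ** N" by simp
  qed
qed

section \<open>Joint eigenvectors of a commuting family\<close>

definition joint_eigenvectors :: "'i set \<Rightarrow> ('i \<Rightarrow> 'a::field^'n^'n) \<Rightarrow> ('a^'n) set" where
  "joint_eigenvectors I X = {v. \<exists>\<mu>. \<forall>i\<in>I. X i *v v = \<mu> i *s v}"

text \<open>Induction on \<open>I\<close>: the spectral projections of the new matrix
  \<open>X m\<close> split a joint eigenvector of the old family into pieces that are eigenvectors
  of \<open>X m\<close> or zero. The pieces keep the old eigenvalues because the projections commute
  with each old \<open>X i\<close>.\<close>

lemma span_joint_eigenvectors:
  fixes X :: "'i \<Rightarrow> 'a::field^'n^'n"
  assumes "finite I" "\<And>i. i \<in> I \<Longrightarrow> diagonalizable_matrix (X i)"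
    and "\<And>i j. i \<in> I \<Longrightarrow> j \<in> I \<Longrightarrow> X i ** X j = X j ** X i"
  shows "vec.span (joint_eigenvectors I X) = UNIV"
  using assms
proof (induction I rule: finite_induct)
  case empty
  then show ?case by (simp add: joint_eigenvectors_def)
next
  case (insert m I)
  obtain Pr :: "'a \<Rightarrow> 'a^'n^'n" and S where fin: "finite S" and sum: "(\<Sum>c\<in>S. Pr c) = mat 1"
    and eig: "\<And>c. X m ** Pr c = matrix_scale c (Pr c)"
    and comm: "\<And>c N. N ** X m = X m ** N \<Longrightarrow> N ** Pr c = Pr c ** N"
    using diagonalizable_spectral_projections insert.prems(1) by (metis insertI1)
  have "u \<in> vec.span (joint_eigenvectors (insert m I) X)" if u: "u \<in> joint_eigenvectors I X" for u
  proof -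
    obtain \<mu> where \<mu>: "\<And>i. i \<in> I \<Longrightarrow> X i *v u = \<mu> i *s u"
      using u by (auto simp: joint_eigenvectors_def)
    have mem: "Pr c *v u \<in> joint_eigenvectors (insert m I) X" for c
    proof -
      have "X m *v (Pr c *v u) = c *s (Pr c *v u)"
        by (simp add: matrix_vector_mul_assoc eig)
           (simp add: matrix_scale_def matrix_vector_mult_def vec_eq_iff sum_distrib_left mult.assoc)
      moreover have "X i *v (Pr c *v u) = \<mu> i *s (Pr c *v u)" if "i \<in> I" for i
      proof -
        have "X i ** Pr c = Pr c ** X i" using insert.prems(2) that by (intro comm) auto
        then have "X i *v (Pr c *v u) = Pr c *v (X i *v u)"
          by (simp add: matrix_vector_mul_assoc)
        then show ?thesis by (simp add: \<mu>[OF that] vector_scalar_commute)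
      qed
      ultimately have "\<forall>i\<in>insert m I. X i *v (Pr c *v u) = (\<mu>(m := c)) i *s (Pr c *v u)"
        using insert.hyps by auto
      then show ?thesis unfolding joint_eigenvectors_def by blast
    qed
    have "(\<Sum>c\<in>S. Pr c *v u) = (\<Sum>c\<in>S. Pr c) *v u"
      using fin by induction (simp_all add: matrix_vector_mult_add_rdistrib)
    then have "u = (\<Sum>c\<in>S. Pr c *v u)" by (simp add: sum)
    then show ?thesis
      by (metis (no_types, lifting) mem vec.span_base vec.span_sum)
  qed
  then have "vec.span (joint_eigenvectors I X) \<subseteq> vec.span (joint_eigenvectors (insert m I) X)"
    by (intro vec.span_minimal) auto
  with insert show ?case by auto
qed

section \<open>Symmetric bilinear forms\<close>

text \<open>No conjugation occurs, so over the complex numbers a nonzero \<open>x\<close> may be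
  isotropic, that is, \<open>bform B x x = 0\<close>.\<close>

definition bform :: "'a::field^'n^'n \<Rightarrow> 'a^'n \<Rightarrow> 'a^'n \<Rightarrow> 'a" where
  "bform B x y = (\<Sum>a\<in>UNIV. x $ a * (B *v y) $ a)"

lemma bform_add_left: "bform B (x + y) z = bform B x z + bform B y z"
  by (simp add: bform_def sum.distrib algebra_simps)

lemma bform_scale_left: "bform B (c *s x) z = c * bform B x z"
  by (simp add: bform_def sum_distrib_left mult.assoc)

lemma bform_add_right: "bform B z (x + y) = bform B z x + bform B z y"
  by (simp add: bform_def sum.distrib algebra_simps)

lemma bform_scale_right: "bform B z (c *s x) = c * bform B z x"
  by (simp add: bform_def sum_distrib_left vector_scalar_commute mult.left_commute)

lemma bform_zero_left: "bform B 0 z = 0"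
  by (simp add: bform_def)

lemma bform_zero_right: "bform B z 0 = 0"
  by (simp add: bform_def)

lemma bform_sum_left: "bform B (\<Sum>i\<in>I. f i) z = (\<Sum>i\<in>I. bform B (f i) z)"
  by (induction I rule: infinite_finite_induct) (simp_all add: bform_add_left bform_zero_left)

lemma bform_diff_left: "bform B (x - y) z = bform B x z - bform B y z"
  using bform_add_left[of B "x - y" y z] by simp

lemma bform_mult_right: "bform B x (M *v y) = bform (B ** M) x y"
  by (simp add: bform_def matrix_vector_mul_assoc)

lemma bform_commute:
  assumes "symmetric_matrix B"
  shows "bform B x y = bform B y x"
proof -
  have B: "B $ i $ j = B $ j $ i" for i j
    using arg_cong[OF assms[unfolded symmetric_matrix_def], of "\<lambda>M. M $ i $ j"]
    by (simp add: transpose_def)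
  have "bform B x y = (\<Sum>i\<in>UNIV. \<Sum>j\<in>UNIV. x $ i * (B $ i $ j * y $ j))"
    by (simp add: bform_def matrix_vector_mult_def sum_distrib_left)
  also have "\<dots> = (\<Sum>j\<in>UNIV. \<Sum>i\<in>UNIV. y $ j * (B $ j $ i * x $ i))"
    by (subst sum.swap) (simp add: B mult_ac)
  also have "\<dots> = bform B y x"
    by (simp add: bform_def matrix_vector_mult_def sum_distrib_left)
  finally show ?thesis .
qed

text \<open>Taking for \<open>y\<close> the preimage under \<open>B\<close> of a unit vector reads
  off one coordinate of \<open>x\<close>.\<close>

lemma bform_nondegenerate:
  assumes "invertible B" "\<And>y. bform B x y = 0"
  shows "x = 0"
proof -
  have "x $ a = 0" for a
  proof -
    have "B *v (matrix_inv B *v axis a 1) = axis a 1"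
      by (simp add: matrix_vector_mul_assoc assms(1))
    then have "bform B x (matrix_inv B *v axis a 1) = (\<Sum>i\<in>UNIV. if i = a then x $ a else 0)"
      unfolding bform_def by (intro sum.cong) (auto simp: axis_def)
    then show ?thesis using assms(2) by simp
  qed
  then show ?thesis by (simp add: vec_eq_iff)
qed

section \<open>Orthogonal sets and orthogonal bases\<close>

text \<open>Isotropic vectors are excluded so that independence follows and projections may divide
  by \<open>bform B v v\<close>.\<close>

definition orthogonal_set :: "'a::field^'n^'n \<Rightarrow> ('a^'n) set \<Rightarrow> bool" where
  "orthogonal_set B T \<longleftrightarrow> (\<forall>u\<in>T. bform B u u \<noteq> 0) \<and> (\<forall>u\<in>T. \<forall>v\<in>T. u \<noteq> v \<longrightarrow> bform B u v = 0)"

text \<open>Pairing a vanishing combination with \<open>v\<close> leaves only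
  \<open>c v * bform B v v\<close>.\<close>

lemma orthogonal_set_independent:
  assumes "finite T" "orthogonal_set B T"
  shows "vec.independent T"
proof
  assume "vec.dependent T"
  then obtain c v where v: "v \<in> T" "c v \<noteq> 0" and 0: "(\<Sum>u\<in>T. c u *s u) = 0"
    using vec.dependent_finite[OF assms(1)] by auto
  have "bform B (\<Sum>u\<in>T. c u *s u) v = (\<Sum>u\<in>T. if u = v then c v * bform B v v else 0)"
    unfolding bform_sum_left bform_scale_left
    using assms(2) v(1) by (intro sum.cong) (auto simp: orthogonal_set_def)
  then show False using v 0 assms by (auto simp: bform_zero_left orthogonal_set_def)
qed

text \<open>The closure hypothesis on \<open>E\<close> is what remains of ``joint eigenvectors with distinct
  eigenvalues are orthogonal''.\<close>

lemma orthogonal_basis_within: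
  fixes B :: "'a::field_char_0^'n^'n"
  assumes sym: "symmetric_matrix B" and inv: "invertible B"
    and span: "vec.span E = UNIV"
    and cl: "\<And>u w c. u \<in> E \<Longrightarrow> w \<in> E \<Longrightarrow> bform B u w \<noteq> 0 \<Longrightarrow> u + c *s w \<in> E"
  obtains T where "T \<subseteq> E" "finite T" "orthogonal_set B T" "vec.span T = UNIV"
proof -
  define Q where "Q T \<longleftrightarrow> T \<subseteq> E \<and> finite T \<and> orthogonal_set B T" for T
  have "Q {}" by (simp add: Q_def orthogonal_set_def)
  \<comment> \<open>Independence bounds the size of orthogonal sets by the dimension, so
    \<open>E\<close> contains one of maximal cardinality.\<close>
  moreover have "card T \<le> CARD('n)" if "Q T" for T
    using that orthogonal_set_independent vec.independent_card_le_dim[of T UNIV]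
    unfolding Q_def vec_dim_card by blast
  ultimately obtain T where T: "Q T" and max: "\<And>T'. Q T' \<Longrightarrow> card T' \<le> card T"
    using ex_has_greatest_nat[of Q "{}" card "Suc CARD('n)"] by (auto simp: less_Suc_eq_le)
  have TE: "T \<subseteq> E" and fin: "finite T" and orth: "orthogonal_set B T"
    using T by (auto simp: Q_def)
  \<comment> \<open>Otherwise \<open>u\<close> could be added to \<open>T\<close>, against
    maximality.\<close>
  have isotropic: "bform B u u = 0" if "u \<in> E" "\<And>v. v \<in> T \<Longrightarrow> bform B u v = 0" for u
  proof (rule ccontr)
    assume nz: "bform B u u \<noteq> 0"
    then have "u \<notin> T" using that(2) by blast
    moreover have "Q (insert u T)"
      using nz that orth TE fin bform_commute[OF sym] by (auto simp: Q_def orthogonal_set_def)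
    ultimately show False using max[of "insert u T"] fin by simp
  qed
  \<comment> \<open>Polarization: if \<open>u\<close> and \<open>w\<close> were not orthogonal,
    \<open>u + w\<close> would lie in \<open>E\<close> and, being orthogonal to \<open>T\<close>, be
    isotropic. As \<open>u\<close> and \<open>w\<close> are isotropic too, this leaves
    \<open>2 * bform B u w = 0\<close>, impossible in characteristic 0.\<close>
  have perp: "bform B u w = 0"
    if u: "u \<in> E" "\<And>v. v \<in> T \<Longrightarrow> bform B u v = 0" and w: "w \<in> E" "\<And>v. v \<in> T \<Longrightarrow> bform B w v = 0"
    for u w
  proof (rule ccontr)
    assume nz: "bform B u w \<noteq> 0"
    then have "u + w \<in> E" using cl[OF u(1) w(1), of 1] by simp
    then have "bform B (u + w) (u + w) = 0"
      by (rule isotropic) (simp add: bform_add_left u w)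
    then have "2 * bform B u w = 0"
      using isotropic[OF u] isotropic[OF w] bform_commute[OF sym, of u w]
      by (simp add: bform_add_left bform_add_right)
    with nz show False by simp
  qed
  \<comment> \<open>The Gram--Schmidt remainder of \<open>u\<close>, for subsets \<open>F\<close> of
    \<open>T\<close> so that projections can be subtracted one at a time.\<close>
  define pr where "pr F u = u - (\<Sum>v\<in>F. (bform B u v / bform B v v) *s v)" for F u
  have pr_bform: "bform B (pr F u) v = (if v \<in> F then 0 else bform B u v)"
    if "F \<subseteq> T" "v \<in> T" for F u v
  proof -
    have "bform B (\<Sum>x\<in>F. (bform B u x / bform B x x) *s x) v
        = (\<Sum>x\<in>F. if x = v then bform B u v else 0)"
      unfolding bform_sum_left bform_scale_left
      using orth that by (intro sum.cong) (auto simp: orthogonal_set_def)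
    then show ?thesis
      using finite_subset[OF that(1) fin] by (simp add: pr_def bform_diff_left)
  qed
  \<comment> \<open>Each subtraction either has coefficient 0 or involves a vector not orthogonal to
    the current remainder, which is the case that \<open>cl\<close> covers.\<close>
  have pr_E: "pr F u \<in> E" if "u \<in> E" "F \<subseteq> T" for F u
    using finite_subset[OF that(2) fin] that(2)
  proof induction
    case empty
    then show ?case by (simp add: pr_def that)
  next
    case (insert x F)
    have eq: "pr (insert x F) u = pr F u + (- (bform B u x / bform B x x)) *s x"
      using insert.hyps
      by (simp add: pr_def algebra_simps)
    have "bform B (pr F u) x = bform B u x" using insert pr_bform by simp
    moreover have "pr F u \<in> E" "x \<in> E" using insert TE by auto
    ultimately show ?case
      unfolding eq by (cases "bform B u x = 0") (simp, intro cl, auto)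
  qed
  \<comment> \<open>Any \<open>w\<close> in \<open>E\<close> is \<open>pr T w\<close> plus a
    combination of \<open>T\<close>. The remainder of \<open>u\<close> is orthogonal to both, hence
    to the span of \<open>E\<close>, which is everything.\<close>
  have pr_0: "pr T u = 0" if u: "u \<in> E" for u
  proof (rule bform_nondegenerate[OF inv])
    have "bform B (pr T u) w = 0" if "w \<in> E" for w
    proof -
      have pT: "bform B (pr T x) v = 0" if "v \<in> T" for x v using pr_bform[of T] that by simp
      have "bform B (pr T u) (pr T w) = 0"
        by (rule perp) (use u \<open>w \<in> E\<close> pr_E pT in auto)
      moreover have "bform B (pr T u) w = bform B w (pr T u)" by (rule bform_commute[OF sym])
      moreover have "bform B w (pr T u) = bform B (pr T w) (pr T u)
          + bform B (\<Sum>v\<in>T. (bform B w v / bform B v v) *s v) (pr T u)"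
        unfolding pr_def[of T w] bform_diff_left by simp
      moreover have "bform B (\<Sum>v\<in>T. (bform B w v / bform B v v) *s v) (pr T u) = 0"
        unfolding bform_sum_left bform_scale_left
        using pT bform_commute[OF sym] by (intro sum.neutral) auto
      ultimately show ?thesis using bform_commute[OF sym] by simp
    qed
    then have "E \<subseteq> {w. bform B (pr T u) w = 0}" by auto
    then have "vec.span E \<subseteq> {w. bform B (pr T u) w = 0}"
      by (rule vec.span_minimal)
        (simp add: vec.subspace_def bform_add_right bform_scale_right bform_zero_right)
    then show "bform B (pr T u) w = 0" for w using span by auto
  qed
  have "E \<subseteq> vec.span T"
  proof
    fix u assume "u \<in> E"
    then have "u = (\<Sum>v\<in>T. (bform B u v / bform B v v) *s v)"
      using pr_0 by (simp add: pr_def)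
    then show "u \<in> vec.span T"
      by (metis (no_types, lifting) vec.span_base vec.span_scale vec.span_sum)
  qed
  then have "vec.span T = UNIV"
    using vec.span_minimal[of E "vec.span T"] span by auto
  with that TE fin orth show thesis by blast
qed

text \<open>The congruent matrix is a Gram matrix, so it is diagonal exactly when distinct columns
  of \<open>P\<close> pair to zero under \<open>M\<close>.\<close>

lemma bform_matrix_entry:
  "(transpose P ** M ** P) $ i $ j = bform M (column i P) (column j P)"
proof -
  have "transpose P ** M ** P = transpose P ** (M ** P)" by (simp add: matrix_mul_assoc)
  then show ?thesis
    by (simp add: bform_def matrix_matrix_mult_def matrix_vector_mult_def column_def transpose_def)
qed

section \<open>Simultaneous diagonalization by congruence\<close>

text \<open>On a joint eigenvector the form of \<open>A i = B ** X i\<close> is a multiple of the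
  form of \<open>B\<close>, so a \<open>B\<close>-orthogonal basis of joint eigenvectors is
  orthogonal for all \<open>A i\<close> at once.\<close>

lemma congruence_diagonalization:
  fixes A :: "'i \<Rightarrow> 'a::field_char_0^'n^'n"
  assumes "finite I" and B: "symmetric_matrix B" "invertible B"
    and sym: "\<And>i. i \<in> I \<Longrightarrow> symmetric_matrix (A i)"
    and diag: "\<And>i. i \<in> I \<Longrightarrow> diagonalizable_matrix (matrix_inv B ** A i)"
    and comm: "\<And>i j. i \<in> I \<Longrightarrow> j \<in> I \<Longrightarrow>
      (matrix_inv B ** A i) ** (matrix_inv B ** A j) = (matrix_inv B ** A j) ** (matrix_inv B ** A i)"
  obtains \<Lambda> :: "'i \<Rightarrow> 'a^'n^'n" and R where "invertible R"
    "\<forall>i\<in>I. diagonal_matrix (\<Lambda> i) \<and> A i = R ** \<Lambda> i ** transpose R"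
proof -
  define X where "X i = matrix_inv B ** A i" for i
  define E where "E = joint_eigenvectors I X"
  have BX: "B ** X i = A i" for i
    by (simp add: X_def matrix_mul_assoc B)
  have E_span: "vec.span E = UNIV"
    unfolding E_def by (rule span_joint_eigenvectors) (use assms in \<open>auto simp: X_def\<close>)
  \<comment> \<open>Symmetry of \<open>B\<close> and \<open>A i\<close> makes \<open>X i\<close>
    self-adjoint for \<open>B\<close>, so non-orthogonal joint eigenvectors have the same
    eigenvalues and their combinations stay in one joint eigenspace.\<close>
  have E_cl: "u + c *s w \<in> E" if "u \<in> E" "w \<in> E" and nz: "bform B u w \<noteq> 0" for u w c
  proof -
    obtain \<mu> \<nu> where \<mu>: "\<And>i. i \<in> I \<Longrightarrow> X i *v u = \<mu> i *s u"
      and \<nu>: "\<And>i. i \<in> I \<Longrightarrow> X i *v w = \<nu> i *s w"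
      using \<open>u \<in> E\<close> \<open>w \<in> E\<close> unfolding E_def joint_eigenvectors_def by blast
    have "X i *v (u + c *s w) = \<mu> i *s (u + c *s w)" if i: "i \<in> I" for i
    proof -
      have "\<nu> i * bform B u w = bform (A i) u w"
        by (metis BX \<nu>[OF i] bform_mult_right bform_scale_right)
      also have "\<dots> = bform (A i) w u" by (rule bform_commute[OF sym[OF i]])
      also have "\<dots> = \<mu> i * bform B w u"
        by (metis BX \<mu>[OF i] bform_mult_right bform_scale_right)
      also have "\<dots> = \<mu> i * bform B u w" using bform_commute[OF B(1)] by metis
      finally have "\<nu> i = \<mu> i" using nz by simp
      then show ?thesis
        by (simp add: vector_scalar_commute \<mu>[OF i] \<nu>[OF i]
            vec_eq_iff algebra_simps)
    qed
    then show ?thesis by (auto simp: E_def joint_eigenvectors_def)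
  qed
  obtain T where T: "T \<subseteq> E" "finite T" "orthogonal_set B T" "vec.span T = UNIV"
    using orthogonal_basis_within[OF B E_span E_cl] by blast
  \<comment> \<open>The basis can thus be indexed by \<open>'n\<close> and form the columns of a
    square matrix.\<close>
  have "card T = CARD('n)"
    using vec.dim_span_eq_card_independent[OF orthogonal_set_independent[OF T(2,3)]]
    unfolding T(4) vec_dim_card by simp
  then obtain f :: "'n \<Rightarrow> 'a^'n" where f: "bij_betw f UNIV T"
    using finite_same_card_bij[OF finite T(2)] by auto
  define P :: "'a^'n^'n" where "P = (\<chi> a j. f j $ a)"
  have col: "column j P = f j" for j by (simp add: P_def column_def vec_eq_iff)
  have "columns P = T"
    using f by (auto simp: columns_def col bij_betw_def)
  then have P: "invertible P"
    using T(4) matrix_right_invertible_span_columns invertible_right_inverse by metis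
  then have Pt: "invertible (transpose P)" by (rule invertible_transpose)
  define R where "R = matrix_inv (transpose P)"
  have RP: "R ** transpose P = mat 1" by (simp add: R_def Pt)
  then have PR: "P ** transpose R = mat 1"
    by (metis matrix_transpose_mul transpose_mat transpose_transpose)
  show thesis
  proof (rule that[of R "\<lambda>i. transpose P ** A i ** P"])
    show "invertible R" unfolding R_def using Pt by (rule invertible_matrix_inv)
    show "\<forall>i\<in>I. diagonal_matrix (transpose P ** A i ** P) \<and>
        A i = R ** (transpose P ** A i ** P) ** transpose R"
    proof
      fix i assume i: "i \<in> I"
      have "R ** (transpose P ** A i ** P) ** transpose R
          = (R ** transpose P) ** A i ** (P ** transpose R)"
        by (simp add: matrix_mul_assoc)
      then have "A i = R ** (transpose P ** A i ** P) ** transpose R" by (simp add: RP PR)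
      moreover have "diagonal_matrix (transpose P ** A i ** P)"
        unfolding diagonal_matrix_def bform_matrix_entry col
      proof (intro allI impI)
        fix j l :: 'n assume "j \<noteq> l"
        then have ne: "f j \<noteq> f l" "f j \<in> T" "f l \<in> T" using f by (auto simp: bij_betw_def inj_def)
        then obtain \<mu> where "X i *v f l = \<mu> i *s f l"
          using T(1) i by (auto simp: E_def joint_eigenvectors_def)
        then have "bform (A i) (f j) (f l) = \<mu> i * bform B (f j) (f l)"
          by (metis BX bform_mult_right bform_scale_right)
        then show "bform (A i) (f j) (f l) = 0" using T(3) ne by (simp add: orthogonal_set_def)
      qed
      ultimately show "diagonal_matrix (transpose P ** A i ** P) \<and>
          A i = R ** (transpose P ** A i ** P) ** transpose R" by blast
    qed
  qed
qed

section \<open>From congruence to similarity\<close>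

text \<open>In the quotient the inner factors \<open>R\<close> cancel, and what remains is
  \<open>D\<^sup>-\<^sup>1 L\<close> conjugated by \<open>transpose R\<close>.\<close>

lemma congruence_diagonal_quotient:
  fixes R :: "'a::field^'n^'n"
  assumes R: "invertible R" and D: "diagonal_matrix D" "invertible (R ** D ** transpose R)"
    and L: "diagonal_matrix L"
  obtains \<Delta> :: "'a^'n^'n" where "diagonal_matrix \<Delta>"
    "matrix_inv (R ** D ** transpose R) ** (R ** L ** transpose R)
      = matrix_inv (transpose R) ** \<Delta> ** transpose R"
proof -
  have Rt: "invertible (transpose R)" using R by (rule invertible_transpose)
  have RD: "invertible (R ** D)"
  proof -
    have "R ** D = (R ** D ** transpose R) ** matrix_inv (transpose R)"
      by (metis Rt matrix_inv_right matrix_mul_assoc matrix_mul_rid)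
    then show ?thesis using D(2) Rt invertible_matrix_inv invertible_mult by metis
  qed
  \<comment> \<open>Invertibility of \<open>D\<close> is recovered from that of
    \<open>R ** D ** transpose R\<close> by stripping the outer factors.\<close>
  have Di: "invertible D"
  proof -
    have "D = matrix_inv R ** (R ** D)"
      by (simp add: matrix_mul_assoc R)
    then show ?thesis using RD R invertible_matrix_inv invertible_mult by metis
  qed
  have "matrix_inv (R ** D ** transpose R)
      = matrix_inv (transpose R) ** (matrix_inv D ** matrix_inv R)"
    by (simp add: matrix_inv_mult RD Rt R Di)
  then have "matrix_inv (R ** D ** transpose R) ** (R ** L ** transpose R)
      = matrix_inv (transpose R) ** matrix_inv D ** (matrix_inv R ** R) ** L ** transpose R"
    by (simp only: matrix_mul_assoc)
  then have "matrix_inv (R ** D ** transpose R) ** (R ** L ** transpose R)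
      = matrix_inv (transpose R) ** (matrix_inv D ** L) ** transpose R"
    by (simp add: R matrix_mul_assoc)
  moreover have "diagonal_matrix (matrix_inv D ** L)"
    using diagonal_matrix_mult[OF diagonal_matrix_inv[OF D(1) Di] L]
    by (simp add: diagonal_matrix_def)
  ultimately show thesis using that by blast
qed

section \<open>The equivalence for the span of a symmetric family\<close>

theorem theorem2p7:
  fixes A :: "nat \<Rightarrow> complex^'n^'n" and k :: nat and V :: "(complex^'n^'n) set"
  assumes sym: "\<And>i. i \<in> {1..k} \<Longrightarrow> symmetric_matrix (A i)"
    and V: "V = matrix_space.span (A ` {1..k})"
    and nonsing: "\<exists>M\<in>V. invertible M"
  shows "((\<exists>\<Lambda> :: nat \<Rightarrow> complex^'n^'n. \<exists>R :: complex^'n^'n. invertible R \<and>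
            (\<forall>i\<in>{1..k}. diagonal_matrix (\<Lambda> i) \<and> A i = R ** \<Lambda> i ** transpose R))
          \<longleftrightarrow>
          (\<exists>C\<in>V. invertible C \<and> commuting_subspace (inv_translate C V)) \<and>
          (\<exists>B\<in>V. invertible B \<and>
             (\<forall>i\<in>{1..k}. diagonalizable_matrix (matrix_inv B ** A i))))
       \<and>
         ((\<exists>C\<in>V. invertible C \<and> commuting_subspace (inv_translate C V))
          \<longleftrightarrow>
          (\<forall>C\<in>V. invertible C \<longrightarrow> commuting_subspace (inv_translate C V)))"
proof -
  have subV: "matrix_space.subspace V" by (simp add: V)
  have AV: "A i \<in> V" if "i \<in> {1..k}" for i
    using that by (auto simp: V intro: matrix_space.span_base)
  \<comment> \<open>From left to right the base matrix is changed; from right to left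
    \<open>nonsing\<close> supplies a \<open>C\<close>.\<close>
  have ex_all: "(\<exists>C\<in>V. invertible C \<and> commuting_subspace (inv_translate C V))
      \<longleftrightarrow> (\<forall>C\<in>V. invertible C \<longrightarrow> commuting_subspace (inv_translate C V))"
    using commuting_inv_translate_change_base[OF subV] nonsing by blast
  \<comment> \<open>With \<open>C\<close> arbitrary, the element given by \<open>nonsing\<close> can
    witness both conditions.\<close>
  have fwd: "commuting_subspace (inv_translate C V)"
    "\<forall>i\<in>{1..k}. diagonalizable_matrix (matrix_inv C ** A i)"
    if R: "invertible R" and L: "\<forall>i\<in>{1..k}. diagonal_matrix (\<Lambda> i) \<and> A i = R ** \<Lambda> i ** transpose R"
      and C: "C \<in> V" "invertible C"
    for \<Lambda> :: "nat \<Rightarrow> complex^'n^'n" and R C :: "complex^'n^'n"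
  proof -
    define S where "S = matrix_inv (transpose R)"
    have Rt: "invertible (transpose R)" using R by (rule invertible_transpose)
    have S: "invertible S" "transpose R ** S = mat 1" "S ** transpose R = mat 1"
      by (auto simp: S_def Rt invertible_matrix_inv)
    \<comment> \<open>One \<open>R\<close> serves all of \<open>V\<close>, since the congruences by
      \<open>R\<close> of diagonal matrices form a subspace containing the generators.\<close>
    have "V \<subseteq> {R ** D ** transpose R |D. D \<in> {D. diagonal_matrix D}}"
      unfolding V
      by (rule matrix_space.span_minimal[OF _ subspace_sandwich[OF subspace_diagonal_matrix]])
        (use L in auto)
    then have VD: "\<exists>D. diagonal_matrix D \<and> M = R ** D ** transpose R" if "M \<in> V" for M
      using that by blast
    have quot: "\<exists>\<Delta>. diagonal_matrix \<Delta> \<and> matrix_inv C ** M = S ** \<Delta> ** transpose R"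
      if "M \<in> V" for M
      using VD[OF C(1)] VD[OF that] congruence_diagonal_quotient[OF R] C(2)
      unfolding S_def by metis
    have "(matrix_inv C ** M) ** (matrix_inv C ** N) = (matrix_inv C ** N) ** (matrix_inv C ** M)"
      if "M \<in> V" "N \<in> V" for M N
    proof -
      obtain F G where F: "diagonal_matrix F" "matrix_inv C ** M = S ** F ** transpose R"
        and G: "diagonal_matrix G" "matrix_inv C ** N = S ** G ** transpose R"
        using quot \<open>M \<in> V\<close> \<open>N \<in> V\<close> by blast
      have "(S ** X ** transpose R) ** (S ** Y ** transpose R) = S ** (X ** Y) ** transpose R" for X Y
        by (metis S(2) matrix_mul_assoc matrix_mul_rid)
      moreover have "F ** G = G ** F"
        unfolding diagonal_matrix_mult[OF F(1) G(1)] diagonal_matrix_mult[OF G(1) F(1)]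
        by (auto simp: vec_eq_iff)
      ultimately show ?thesis by (simp add: F G)
    qed
    with subspace_inv_translate[OF subV] show "commuting_subspace (inv_translate C V)"
      unfolding commuting_subspace_def inv_translate_def by blast
    have "matrix_inv S = transpose R" using S by (intro matrix_inv_unique) auto
    then show "\<forall>i\<in>{1..k}. diagonalizable_matrix (matrix_inv C ** A i)"
      using quot AV S(1) unfolding diagonalizable_matrix_def by metis
  qed
  have bwd: "\<exists>\<Lambda> :: nat \<Rightarrow> complex^'n^'n. \<exists>R :: complex^'n^'n. invertible R \<and>
      (\<forall>i\<in>{1..k}. diagonal_matrix (\<Lambda> i) \<and> A i = R ** \<Lambda> i ** transpose R)"
    if comm: "commuting_subspace (inv_translate B V)" and B: "B \<in> V" "invertible B"
      and diag: "\<forall>i\<in>{1..k}. diagonalizable_matrix (matrix_inv B ** A i)" for B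
  proof -
    have "V \<subseteq> {M. symmetric_matrix M}"
      unfolding V by (rule matrix_space.span_minimal[OF _ subspace_symmetric_matrix]) (use sym in auto)
    then have symB: "symmetric_matrix B" using B by blast
    have commA: "(matrix_inv B ** A i) ** (matrix_inv B ** A j)
        = (matrix_inv B ** A j) ** (matrix_inv B ** A i)" if "i \<in> {1..k}" "j \<in> {1..k}" for i j
      using comm AV that unfolding commuting_subspace_def inv_translate_def by blast
    show ?thesis
      by (rule congruence_diagonalization[of "{1..k}" B A,
            OF finite_atLeastAtMost symB B(2) sym bspec[OF diag] commA]) blast+
  qed
  show ?thesis
  proof (intro conjI iffI)
    assume "\<exists>\<Lambda> :: nat \<Rightarrow> complex^'n^'n. \<exists>R :: complex^'n^'n. invertible R \<and>
      (\<forall>i\<in>{1..k}. diagonal_matrix (\<Lambda> i) \<and> A i = R ** \<Lambda> i ** transpose R)"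
    with nonsing fwd
    show "\<exists>C\<in>V. invertible C \<and> commuting_subspace (inv_translate C V)"
      and "\<exists>B\<in>V. invertible B \<and> (\<forall>i\<in>{1..k}. diagonalizable_matrix (matrix_inv B ** A i))"
      by metis+
  next
    assume "(\<exists>C\<in>V. invertible C \<and> commuting_subspace (inv_translate C V)) \<and>
      (\<exists>B\<in>V. invertible B \<and> (\<forall>i\<in>{1..k}. diagonalizable_matrix (matrix_inv B ** A i)))"
    \<comment> \<open>The two conditions may come with different matrices; \<open>ex_all\<close>
      moves the commuting property to the \<open>B\<close> of the second.\<close>
    then obtain B where "B \<in> V" "invertible B" "commuting_subspace (inv_translate B V)"
      "\<forall>i\<in>{1..k}. diagonalizable_matrix (matrix_inv B ** A i)"
      using ex_all by blast
    then show "\<exists>\<Lambda> :: nat \<Rightarrow> complex^'n^'n. \<exists>R :: complex^'n^'n. invertible R \<and>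
      (\<forall>i\<in>{1..k}. diagonal_matrix (\<Lambda> i) \<and> A i = R ** \<Lambda> i ** transpose R)"
      by (intro bwd)
  qed (simp_all add: ex_all)
qed

end
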